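(* Let $\ell \ge 3$ be an integer and write $\ell = 2^a + b$ where $2^a \le \ell$ is the largest power of $2$ not exceeding $\ell$ and $b \ge 0$. Then $$k_\ell \ \ge\ \begin{cases} \ell^2 - \ell\log_2 \ell + \log_2 \ell - 1, & b = 0,\\[2pt] \ell^2 - \ell\log_2\ell + \log_2\ell - b\left(2 - \frac{1}{\ln 2}\right) - \frac{b}{\ell}\cdot\frac{1}{\ln 2}, & b \ne 0.\end{cases}$$ As a corollary, for every integer $\ell \ge 3$, $$k_\ell \ \ge\ \ell^2 - \ell\log_2\ell + \log_2\ell - \ell\left(1 - \frac{1}{2\ln 2}\right) - \frac{1}{2\ln 2}.$$
   Context: For an integer $\ell\ge 3$ define a finite integer sequence $f_\ell(1),\dots,f_\ell(\ell)$ as follows. If $\ell$ is not a power of $2$, put $\mu = 2^{\lceil \log_2 \ell\rceil} - \ell$ and $f_\ell(i) = \ell - \lceil \log_2\ell\rceil$ for $1\le i\le \ell-\mu$; $f_\ell(i) = \ell - \lfloor \log_2\ell\rfloor$ for $\ell-\mu+1\le i\le \ell-1$; $f_\ell(\ell)=\ell$. If $\ell$ is a power of $2$, put $f_\ell(1) = \ell-\log_2\ell-1$; $f_\ell(i)=\ell-\log_2\ell$ for $2\le i\le \ell-1$; $f_\ell(\ell)=\ell$. Define $k_\ell = \sum_{i=1}^{\ell} f_\ell(i)$. *)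

theory Defs
  imports Complex_Main
begin

text \<open>The second argument ranges over \<open>1, \<dots>, l\<close>; values outside this range are irrelevant.
  When \<open>l\<close> is a power of two, \<open>\<lfloor>log 2 l\<rfloor>\<close> is just the integer \<open>log 2 l\<close>.
  For \<open>l \<ge> 1\<close> the argument of \<open>nat\<close> below is nonnegative, so nothing is truncated.\<close>

definition mu :: "nat \<Rightarrow> int" where
  "mu l = 2 ^ nat \<lceil>log 2 (real l)\<rceil> - int l"

definition f :: "nat \<Rightarrow> nat \<Rightarrow> int" where
  "f l i =
    (if \<exists>m::nat. l = 2 ^ m then
       (if i = 1 then int l - \<lfloor>log 2 (real l)\<rfloor> - 1
        else if i \<le> l - 1 then int l - \<lfloor>log 2 (real l)\<rfloor>
        else int l)
     else
       (if int i \<le> int l - mu l then int l - \<lceil>log 2 (real l)\<rceil>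
        else if i \<le> l - 1 then int l - \<lfloor>log 2 (real l)\<rfloor>
        else int l))"

definition k :: "nat \<Rightarrow> int" where
  "k l = (\<Sum>i = 1..l. f l i)"

end

theory Submission
  imports Defs
begin

text \<open>Write \<open>l = 2 ^ a + b\<close> with \<open>0 \<le> b < 2 ^ a\<close>. Summing the constant blocks of \<open>f\<close>
  gives \<open>k l = l\<^sup>2 - l * a + a - 2 * b\<close> for \<open>b > 0\<close> (since \<open>l - mu l = 2 * b\<close>), and
  \<open>- 1\<close> in place of \<open>- 2 * b\<close> for \<open>b = 0\<close>. The first bound is thus an equality for \<open>b = 0\<close>, and
  for \<open>b > 0\<close> it reduces to \<open>log 2 l - a \<ge> b / (l * ln 2)\<close>, which is \<open>ln x \<le> x - 1\<close> at
  \<open>x = 2 ^ a / l = 1 - b / l\<close>. The corollary follows from \<open>2 * b \<le> l - 1\<close>.\<close>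

lemma k_power_of_two:
  fixes a :: nat
  assumes "a > 0"
  shows "k (2 ^ a) = (2 ^ a)\<^sup>2 - 2 ^ a * int a + int a - 1"
proof -
  define l :: nat where "l = 2 ^ a"
  \<comment> \<open>From here on the indices \<open>1\<close> and \<open>l\<close> are distinct, so
    the exceptional first value and the last value are two separate terms. For \<open>l = 2\<close>
    the middle block is empty, in accordance with the factor \<open>int l - 2\<close>.\<close>
  have l: "l \<ge> 2"
    using assms self_le_power[of "2::nat" a] by (simp add: l_def)
  have fl: "f l i = (if i = 1 then int l - int a - 1 else if i \<le> l - 1 then int l - int a else int l)" for i
    unfolding f_def l_def by auto
  have ends: "f l 1 = int l - int a - 1" "f l l = int l"
    using l by (auto simp: fl)
  have "{1..l} = insert 1 (insert l {2..l - 1})"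
    using l by auto
  then have "k l = f l 1 + (f l l + (\<Sum>i = 2..l - 1. f l i))"
    using l by (simp add: k_def)
  also have "(\<Sum>i = 2..l - 1. f l i) = (\<Sum>i = 2..l - 1. int l - int a)"
    by (rule sum.cong) (auto simp: fl)
  also have "\<dots> = (int l - 2) * (int l - int a)"
    using l by (simp add: of_nat_diff)
  also have "f l 1 + (f l l + \<dots>) = (int l)\<^sup>2 - int l * int a + int a - 1"
    using l ends by (simp add: algebra_simps power2_eq_square)
  finally show ?thesis
    by (simp add: l_def)
qed

lemma k_not_power_of_two:
  fixes a b :: nat
  assumes "l = 2 ^ a + b" "b > 0" "b < 2 ^ a"
  shows "k l = (int l)\<^sup>2 - int l * int a + int a - 2 * int b"
proof -
  have between: "2 ^ a < l" "l < 2 ^ (a + 1)"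
    using assms by auto
  have fl_log: "\<lfloor>log 2 (real l)\<rfloor> = int a" and cl_log: "\<lceil>log 2 (real l)\<rceil> = int a + 1"
    using floor_log_nat_eq_if[of 2 a l] ceiling_log_nat_eq_if[of 2 a l] between by simp_all
  \<comment> \<open>Comparing exponents would give \<open>a < m < a + 1\<close>;
    \<open>power_Suc\<close> would rewrite the upper bound and hide this.\<close>
  have no_power: "\<nexists>m::nat. l = 2 ^ m"
    using between by (auto simp del: power_Suc)
  have "mu l = 2 ^ a - int b"
    unfolding mu_def cl_log using assms by (simp add: nat_add_distrib)
  then have fl: "f l i = (if i \<le> 2 * b then int l - int a - 1 else if i \<le> l - 1 then int l - int a else int l)" for i
    unfolding f_def fl_log cl_log using no_power assms by auto
  \<comment> \<open>The block of smallest values ends before the last index, so the first branch of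
    \<open>f\<close> does not capture \<open>i = l\<close>.\<close>
  have lt: "2 * b < l"
    using assms by simp
  then have fll: "f l l = int l"
    by (auto simp: fl)
  from lt have "{1..l} = {1..2 * b} \<union> insert l {2 * b + 1..l - 1}"
    by auto
  then have "k l = (\<Sum>i = 1..2 * b. f l i) + (f l l + (\<Sum>i = 2 * b + 1..l - 1. f l i))"
    using lt by (subst k_def) (simp add: sum.union_disjoint)
  also have "(\<Sum>i = 1..2 * b. f l i) = (\<Sum>i = 1..2 * b. int l - int a - 1)"
    by (rule sum.cong) (auto simp: fl)
  also have "(\<Sum>i = 2 * b + 1..l - 1. f l i) = (\<Sum>i = 2 * b + 1..l - 1. int l - int a)"
    by (rule sum.cong) (auto simp: fl)
  also have "\<dots> = (int l - 1 - 2 * int b) * (int l - int a)"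
    using lt by (simp add: of_nat_diff)
  finally show ?thesis
    using lt fll by (simp add: algebra_simps power2_eq_square)
qed

lemma log2_excess_ge:
  fixes a b :: nat
  assumes "l = 2 ^ a + b"
  shows "log 2 (real l) - real a \<ge> real b / real l * (1 / ln 2)"
proof -
  have pos: "real l > 0"
    using assms by (simp add: add_pos_nonneg)
  have "ln (2 ^ a / real l) \<le> 2 ^ a / real l - 1"
    using pos by (intro ln_le_minus_one) simp
  also have "\<dots> = - (real b / real l)"
    using pos assms by (simp add: field_simps)
  also have "ln (2 ^ a / real l) = real a * ln 2 - ln (real l)"
    using pos by (simp add: ln_div ln_realpow)
  finally have "real b / real l * (1 / ln 2) \<le> (ln (real l) - real a * ln 2) * (1 / ln 2)"
    by (intro mult_right_mono) auto
  then show ?thesis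
    by (simp add: log_def diff_divide_distrib)
qed

text \<open>The condition \<open>b < 2 ^ a\<close> expresses the maximality of \<open>2 ^ a\<close>
  in a form that serves both the first claim and the decomposition chosen for the corollary.\<close>

lemma k_ge:
  fixes a b :: nat
  assumes "l \<ge> 3" "l = 2 ^ a + b" "b < 2 ^ a"
  shows "real_of_int (k l) \<ge>
              (if b = 0
               then real l ^ 2 - real l * log 2 (real l) + log 2 (real l) - 1
               else real l ^ 2 - real l * log 2 (real l) + log 2 (real l)
                      - real b * (2 - 1 / ln 2) - (real b / real l) * (1 / ln 2))"
proof (cases "b = 0")
  case True
  then have "l = 2 ^ a" "a > 0"
    using assms by (auto intro: gr0I)
  then show ?thesis
    using True by (simp add: k_power_of_two)
next
  case False
  define L where "L = log 2 (real l)"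
  \<comment> \<open>In \<open>k l\<close> the exponent \<open>a\<close> has coefficient
    \<open>-(l - 1)\<close>. Replacing it by \<open>L\<close> therefore leaves exactly the surplus
    \<open>(l - 1) * (L - a)\<close>, to be set against the loss \<open>2 * b\<close>.\<close>
  have "(real l - 1) * (real b / real l * (1 / ln 2)) \<le> (real l - 1) * (L - real a)"
    unfolding L_def using log2_excess_ge[OF assms(2)] assms(1) by (intro mult_left_mono) auto
  moreover have "(real l - 1) * (real b / real l * (1 / ln 2))
      = real b * (1 / ln 2) - real b / real l * (1 / ln 2)"
    using assms(1) by (simp add: field_simps)
  moreover have "real_of_int (k l) = (real l)\<^sup>2 - real l * real a + real a - 2 * real b"
    using False assms by (simp add: k_not_power_of_two)
  ultimately show ?thesis
    using False unfolding L_def[symmetric] by (simp add: algebra_simps)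
qed

theorem proposition2p1:
  fixes l :: nat
  assumes "l \<ge> 3"
  shows "(\<forall>a b :: nat.
            l = 2 ^ a + b \<and> (2::nat) ^ a \<le> l \<and> (\<forall>m::nat. (2::nat) ^ m \<le> l \<longrightarrow> (2::nat) ^ m \<le> 2 ^ a) \<longrightarrow>
            real_of_int (k l) \<ge>
              (if b = 0
               then real l ^ 2 - real l * log 2 (real l) + log 2 (real l) - 1
               else real l ^ 2 - real l * log 2 (real l) + log 2 (real l)
                      - real b * (2 - 1 / ln 2) - (real b / real l) * (1 / ln 2)))
         \<and> real_of_int (k l) \<ge>
              real l ^ 2 - real l * log 2 (real l) + log 2 (real l)
                - real l * (1 - 1 / (2 * ln 2)) - 1 / (2 * ln 2)"
proof (intro conjI allI impI)
  fix a b :: nat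
  assume *: "l = 2 ^ a + b \<and> (2::nat) ^ a \<le> l \<and> (\<forall>m::nat. (2::nat) ^ m \<le> l \<longrightarrow> (2::nat) ^ m \<le> 2 ^ a)"
  have "\<not> (2::nat) ^ Suc a \<le> l"
  proof
    assume "(2::nat) ^ Suc a \<le> l"
    with * have "(2::nat) ^ Suc a \<le> 2 ^ a"
      by blast
    then show False
      by simp
  qed
  with * have "b < 2 ^ a"
    by simp
  with * show "real_of_int (k l) \<ge>
              (if b = 0
               then real l ^ 2 - real l * log 2 (real l) + log 2 (real l) - 1
               else real l ^ 2 - real l * log 2 (real l) + log 2 (real l)
                      - real b * (2 - 1 / ln 2) - (real b / real l) * (1 / ln 2))"
    using assms by (intro k_ge) auto
next
  obtain a where a: "2 ^ a \<le> l" "l < 2 ^ (a + 1)"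
    using ex_power_ivl1[of 2 l] assms by auto
  define b where "b = l - 2 ^ a"
  have lab: "l = 2 ^ a + b" and b: "b < 2 ^ a"
    using a by (auto simp: b_def)
  define L where "L = log 2 (real l)"
  define c :: real where "c = 1 / (2 * ln 2)"
  have c2: "1 / ln 2 = 2 * c"
    by (simp add: c_def)
  \<comment> \<open>This yields \<open>ln 2 \<ge> 1 / 2\<close>, hence \<open>c \<le> 1\<close>, so
    that \<open>1 - c\<close> is a nonnegative factor below.\<close>
  have "ln (1 / 2 :: real) \<le> 1 / 2 - 1"
    by (intro ln_le_minus_one) simp
  then have "ln (2 :: real) \<ge> 1 / 2"
    by (simp add: ln_div)
  then have c: "0 \<le> c" "c \<le> 1"
    by (auto simp: c_def field_simps)
  note k_ge' = k_ge[OF assms lab b, unfolded c2, folded L_def]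
  have "real_of_int (k l) \<ge> (real l)\<^sup>2 - real l * L + L - real l * (1 - c) - c"
  proof (cases "b = 0")
    case True
    \<comment> \<open>This product is the gap between the permitted loss
      \<open>l * (1 - c) + c\<close> and the actual loss \<open>1\<close>.\<close>
    have "0 \<le> (real l - 1) * (1 - c)"
      using assms c by simp
    then show ?thesis
      using k_ge' True by (simp add: algebra_simps)
  next
    case False
    have "2 * b + 1 \<le> l"
      using lab b by simp
    then have "2 * real b + 1 \<le> real l"
      by linarith
    \<comment> \<open>The left sides are the two loss terms of \<open>k_ge'\<close>. Their bounds
      add up to \<open>l * (1 - c) + c - (1 - c)\<close>, which is within the permitted loss because
      \<open>c \<le> 1\<close>.\<close>
    then have "2 * real b * (1 - c) \<le> (real l - 1) * (1 - c)" "2 * real b / real l * c \<le> 1 * c"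
      using c assms by (intro mult_right_mono; simp)+
    then show ?thesis
      using k_ge' False c(2) by (simp add: algebra_simps)
  qed
  then show "real_of_int (k l) \<ge>
              real l ^ 2 - real l * log 2 (real l) + log 2 (real l)
                - real l * (1 - 1 / (2 * ln 2)) - 1 / (2 * ln 2)"
    by (simp only: L_def c_def)
qed

end
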